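(* For every $r$-prover question set $\overline{Q}$, $\lim_{n\to\infty}\omega^{\mathrm{CPR}}_{\overline{Q}}(n) = +\infty$.
   Context: An $r$-prover question set is a finite nonempty $\overline{Q}\subseteq Q^{(1)}\times\cdots\times Q^{(r)}$ with finite $Q^{(j)}$ such that every element of each $Q^{(j)}$ occurs as a $j$-th coordinate of some tuple of $\overline{Q}$. An $r$-prover coloring game $\mathcal{G}=(\overline{Q},\overline{A},V)$ consists of a question set $\overline{Q}$, an answer set $\overline{A}=A^{(1)}\times\cdots\times A^{(r)}$ (finite alphabets) and a function $V:\overline{Q}\times\overline{A}\to\mathcal{X}$ for some set $\mathcal{X}$. A strategy is $\overline{\mathcal{S}}=(\mathcal{S}^{(1)},\dots,\mathcal{S}^{(r)})$ with $\mathcal{S}^{(j)}:Q^{(j)}\to A^{(j)}$; write $\overline{\mathcal{S}}(\overline{q})=(\mathcal{S}^{(1)}(q^{(1)}),\dots,\mathcal{S}^{(r)}(q^{(r)}))$. The color-value is $\mathrm{cVal}(\mathcal{G})=\min_{\overline{\mathcal{S}}}\left|\{V(\overline{q},\overline{\mathcal{S}}(\overline{q})):\overline{q}\in\overline{Q}\}\right|$. The $n$-fold parallel repetition $\mathcal{G}^n$ is the coloring game with question set $\overline{Q}^n$ (prover $j$ receives the $n$ $j$-th coordinates), answer alphabets $(A^{(j)})^n$, and function $V^n$ that outputs the vector $(V(\overline{q}_1,\overline{a}_1),\dots,V(\overline{q}_n,\overline{a}_n))$ obtained by applying $V$ coordinatewise. Finally, $\omega^{\mathrm{CPR}}_{\overline{Q}}(n)=\min_{\mathcal{G}}\mathrm{cVal}(\mathcal{G}^n)$,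 the minimum over all coloring games $\mathcal{G}$ with question set $\overline{Q}$ and $\mathrm{cVal}(\mathcal{G})\ge 2$. *)

theory Defs
  imports Complex_Main "HOL-Library.FuncSet" "HOL-Library.Extended_Nat"
    "HOL-Library.Extended_Real" "HOL-Library.Countable_Set"
begin

text \<open>
  The provers of an \<open>r\<close>-prover game are numbered \<open>0, \<dots>, r - 1\<close>. Tuples indexed by the provers
  or by the \<open>n\<close> rounds of a repeated game are extensional functions on \<open>{..<r}\<close> or \<open>{..<n}\<close>
  (elements of a \<open>Pi\<^sub>E\<close>). All provers draw their questions from sets over one common
  type, which loses nothing: finitely many types embed in their disjoint sum.
\<close>

record 'q question_set =
  provers :: nat
  questions :: "nat \<Rightarrow> 'q set"
  tuples :: "(nat \<Rightarrow> 'q) set"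

definition is_question_set :: "'q question_set \<Rightarrow> bool" where
  "is_question_set Q \<longleftrightarrow>
     (\<forall>j<provers Q. finite (questions Q j)) \<and>
     tuples Q \<subseteq> (\<Pi>\<^sub>E j\<in>{..<provers Q}. questions Q j) \<and>
     finite (tuples Q) \<and> tuples Q \<noteq> {} \<and>
     (\<forall>j<provers Q. \<forall>x\<in>questions Q j. \<exists>q\<in>tuples Q. q j = x)"

record ('q, 'a, 'x) coloring_game =
  qset :: "'q question_set"
  alphabet :: "nat \<Rightarrow> 'a set"
  colour :: "(nat \<Rightarrow> 'q) \<Rightarrow> (nat \<Rightarrow> 'a) \<Rightarrow> 'x"

text \<open>
  Alphabets are nonempty, so that strategies exist and the minimum defining the color-value makes
  sense.
\<close>

definition is_coloring_game :: "('q, 'a, 'x) coloring_game \<Rightarrow> bool" where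
  "is_coloring_game G \<longleftrightarrow>
     is_question_set (qset G) \<and>
     (\<forall>j<provers (qset G). finite (alphabet G j) \<and> alphabet G j \<noteq> {})"

definition strategies :: "('q, 'a, 'x) coloring_game \<Rightarrow> (nat \<Rightarrow> 'q \<Rightarrow> 'a) set" where
  "strategies G = (\<Pi>\<^sub>E j\<in>{..<provers (qset G)}. (questions (qset G) j \<rightarrow>\<^sub>E alphabet G j))"

definition answers :: "nat \<Rightarrow> (nat \<Rightarrow> 'q \<Rightarrow> 'a) \<Rightarrow> (nat \<Rightarrow> 'q) \<Rightarrow> (nat \<Rightarrow> 'a)" where
  "answers r S q = (\<lambda>j\<in>{..<r}. S j (q j))"

definition num_colours :: "('q, 'a, 'x) coloring_game \<Rightarrow> (nat \<Rightarrow> 'q \<Rightarrow> 'a) \<Rightarrow> nat" where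
  "num_colours G S =
     card {colour G q (answers (provers (qset G)) S q) | q. q \<in> tuples (qset G)}"

definition cVal :: "('q, 'a, 'x) coloring_game \<Rightarrow> nat" where
  "cVal G = Min {num_colours G S | S. S \<in> strategies G}"

text \<open>
  A question of prover \<open>j\<close> in the repeated game is the vector of its \<open>n\<close> questions, so an
  \<open>n\<close>-tuple of elements of the question set is transposed into one vector per prover. The
  function \<open>round_of r i\<close> recovers the prover-indexed tuple of round \<open>i\<close>.
\<close>

definition transpose_rounds :: "nat \<Rightarrow> nat \<Rightarrow> (nat \<Rightarrow> nat \<Rightarrow> 'b) \<Rightarrow> (nat \<Rightarrow> nat \<Rightarrow> 'b)" where
  "transpose_rounds r n t = (\<lambda>j\<in>{..<r}. \<lambda>i\<in>{..<n}. t i j)"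

definition round_of :: "nat \<Rightarrow> nat \<Rightarrow> (nat \<Rightarrow> nat \<Rightarrow> 'b) \<Rightarrow> (nat \<Rightarrow> 'b)" where
  "round_of r i t = (\<lambda>j\<in>{..<r}. t j i)"

definition qset_power :: "nat \<Rightarrow> 'q question_set \<Rightarrow> (nat \<Rightarrow> 'q) question_set" where
  "qset_power n Q =
     \<lparr>provers = provers Q,
      questions = (\<lambda>j. {..<n} \<rightarrow>\<^sub>E questions Q j),
      tuples = transpose_rounds (provers Q) n ` ({..<n} \<rightarrow>\<^sub>E tuples Q)\<rparr>"

definition game_power ::
  "nat \<Rightarrow> ('q, 'a, 'x) coloring_game \<Rightarrow> (nat \<Rightarrow> 'q, nat \<Rightarrow> 'a, nat \<Rightarrow> 'x) coloring_game" where
  "game_power n G =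
     \<lparr>qset = qset_power n (qset G),
      alphabet = (\<lambda>j. {..<n} \<rightarrow>\<^sub>E alphabet G j),
      colour = (\<lambda>q a. \<lambda>i\<in>{..<n}. colour G (round_of (provers (qset G)) i q)
                                        (round_of (provers (qset G)) i a))\<rparr>"

text \<open>
  Alphabets and colors are natural numbers here, so that the minimum ranges over a type. Since the
  alphabets and the set of occurring colors are finite, this is no restriction; see
  \<open>omega_CPR_le\<close> below. The value lies in \<^typ>\<open>enat\<close> because some question sets (for instance
  those with a single tuple) admit no game of color-value at least 2; the minimum over the empty
  set is then \<open>\<infinity>\<close>. In all other cases the infimum is attained, \<^typ>\<open>enat\<close> being well-ordered.
\<close>

definition omega_CPR :: "'q question_set \<Rightarrow> nat \<Rightarrow> enat" where
  "omega_CPR Q n =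
     Inf {enat (cVal (game_power n G)) | G :: ('q, nat, nat) coloring_game.
            is_coloring_game G \<and> qset G = Q \<and> cVal G \<ge> 2}"

lemma is_question_set_power:
  assumes "is_question_set Q"
  shows "is_question_set (qset_power n Q)"
proof -
  let ?T = "transpose_rounds (provers Q) n"
  have fin: "finite (tuples Q)" and ne: "tuples Q \<noteq> {}"
    and sub: "tuples Q \<subseteq> (\<Pi>\<^sub>E j\<in>{..<provers Q}. questions Q j)"
    and ex: "\<And>j x. j < provers Q \<Longrightarrow> x \<in> questions Q j \<Longrightarrow> \<exists>q\<in>tuples Q. q j = x"
    using assms unfolding is_question_set_def by auto
  have "?T ` ({..<n} \<rightarrow>\<^sub>E tuples Q)
      \<subseteq> (\<Pi>\<^sub>E j\<in>{..<provers Q}. ({..<n} \<rightarrow>\<^sub>E questions Q j))"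
  proof (rule image_subsetI)
    fix t assume t: "t \<in> {..<n} \<rightarrow>\<^sub>E tuples Q"
    have "t i j \<in> questions Q j" if "i < n" "j < provers Q" for i j
    proof -
      have "t i \<in> (\<Pi>\<^sub>E j\<in>{..<provers Q}. questions Q j)"
        using t that(1) sub by (auto simp: PiE_iff)
      then show ?thesis
        using that(2) by (simp add: PiE_iff)
    qed
    then show "?T t \<in> (\<Pi>\<^sub>E j\<in>{..<provers Q}. ({..<n} \<rightarrow>\<^sub>E questions Q j))"
      by (auto simp: transpose_rounds_def)
  qed
  moreover have "\<exists>q\<in>?T ` ({..<n} \<rightarrow>\<^sub>E tuples Q). q j = x"
    if j: "j < provers Q" and x: "x \<in> {..<n} \<rightarrow>\<^sub>E questions Q j" for j x
  proof -
    have "\<forall>i\<in>{..<n}. \<exists>q\<in>tuples Q. q j = x i"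
      using ex[OF j] x by (auto simp: PiE_def Pi_def)
    then obtain t where t: "\<And>i. i < n \<Longrightarrow> t i \<in> tuples Q \<and> t i j = x i"
      by (metis lessThan_iff)
    have "?T (restrict t {..<n}) j = x"
      using j x t by (auto simp: transpose_rounds_def fun_eq_iff PiE_def extensional_def)
    then show ?thesis
      using t by (intro bexI[of _ "?T (restrict t {..<n})"]) auto
  qed
  ultimately show ?thesis
    using assms fin ne
    by (auto simp: is_question_set_def qset_power_def PiE_eq_empty_iff intro!: finite_PiE finite_imageI)
qed

lemma is_coloring_game_power:
  assumes "is_coloring_game G"
  shows "is_coloring_game (game_power n G)"
proof -
  have "provers (qset_power n (qset G)) = provers (qset G)"
    by (simp add: qset_power_def)
  then show ?thesis
    using assms is_question_set_power[of "qset G" n]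
    by (auto simp: is_coloring_game_def game_power_def PiE_eq_empty_iff intro!: finite_PiE)
qed

lemma num_colours_set:
  assumes "is_coloring_game G"
  shows "finite {num_colours G S | S. S \<in> strategies G}" "{num_colours G S | S. S \<in> strategies G} \<noteq> {}"
proof -
  have "finite (strategies G)"
    using assms unfolding strategies_def is_coloring_game_def is_question_set_def
    by (intro finite_PiE) auto
  then show "finite {num_colours G S | S. S \<in> strategies G}"
    by simp
  have "strategies G \<noteq> {}"
    using assms unfolding strategies_def is_coloring_game_def
    by (auto simp: PiE_eq_empty_iff)
  then show "{num_colours G S | S. S \<in> strategies G} \<noteq> {}"
    by auto
qed

lemma round_of_in_tuples:
  assumes "q \<in> tuples (qset_power n Q)" "i < n" "is_question_set Q"
  shows "round_of (provers Q) i q \<in> tuples Q"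
proof -
  obtain t where t: "t \<in> {..<n} \<rightarrow>\<^sub>E tuples Q" "q = transpose_rounds (provers Q) n t"
    using assms(1) by (auto simp: qset_power_def)
  have ti: "t i \<in> tuples Q"
    using t assms(2) by auto
  then have "t i \<in> extensional {..<provers Q}"
    using assms(3) by (auto simp: is_question_set_def PiE_def)
  then have "round_of (provers Q) i q = t i"
    using t assms(2) by (auto simp: round_of_def transpose_rounds_def extensional_def fun_eq_iff)
  then show ?thesis
    using ti by simp
qed

text \<open>Relabelling answers by \<open>f\<close> and colors by \<open>g\<close>.\<close>

lemma cVal_relabel_le:
  assumes G: "is_coloring_game G" and H: "is_coloring_game H" and eq: "qset H = qset G"
    and f: "\<And>j a. j < provers (qset G) \<Longrightarrow> a \<in> alphabet G j \<Longrightarrow> f a \<in> alphabet H j"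
    and g: "\<And>q a. q \<in> tuples (qset G) \<Longrightarrow> a \<in> (\<Pi>\<^sub>E j\<in>{..<provers (qset G)}. alphabet G j) \<Longrightarrow>
              colour H q (\<lambda>j\<in>{..<provers (qset G)}. f (a j)) = g (colour G q a)"
  shows "cVal H \<le> cVal G"
proof -
  let ?r = "provers (qset G)"
  have "cVal G \<in> {num_colours G S | S. S \<in> strategies G}"
    unfolding cVal_def using num_colours_set[OF G] by (rule Min_in)
  then obtain S where S: "S \<in> strategies G" "cVal G = num_colours G S"
    by auto
  define S' where "S' = (\<lambda>j\<in>{..<?r}. \<lambda>x\<in>questions (qset G) j. f (S j x))"
  have SA: "S j x \<in> alphabet G j" if "j < ?r" "x \<in> questions (qset G) j" for j x
    using S(1) that unfolding strategies_def by (auto simp: PiE_def Pi_def)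
  have S': "S' \<in> strategies H"
    using SA f unfolding strategies_def S'_def eq by auto
  have qj: "q j \<in> questions (qset G) j" if "q \<in> tuples (qset G)" "j < ?r" for q j
    using G that unfolding is_coloring_game_def is_question_set_def by (auto simp: PiE_def Pi_def)
  have fin: "finite (tuples (qset G))"
    using G unfolding is_coloring_game_def is_question_set_def by auto
  have col: "colour H q (answers ?r S' q) = g (colour G q (answers ?r S q))"
    if q: "q \<in> tuples (qset G)" for q
  proof -
    have "answers ?r S' q = (\<lambda>j\<in>{..<?r}. f (answers ?r S q j))"
      using qj[OF q] by (auto simp: answers_def S'_def fun_eq_iff)
    moreover have "answers ?r S q \<in> (\<Pi>\<^sub>E j\<in>{..<?r}. alphabet G j)"
      using qj[OF q] SA by (auto simp: answers_def)
    ultimately show ?thesis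
      using g[OF q] by simp
  qed
  have "{colour H q (answers ?r S' q) | q. q \<in> tuples (qset G)}
      = g ` {colour G q (answers ?r S q) | q. q \<in> tuples (qset G)}"
    using col by auto (metis (mono_tags, lifting) image_eqI mem_Collect_eq)
  then have "num_colours H S' \<le> num_colours G S"
    using fin unfolding num_colours_def eq by (auto intro!: card_image_le)
  moreover have "cVal H \<le> num_colours H S'"
    unfolding cVal_def using num_colours_set[OF H] S' by (intro Min_le) auto
  ultimately show ?thesis
    using S(2) by simp
qed

lemma cVal_power_relabel_le:
  assumes G: "is_coloring_game G" and H: "is_coloring_game H" and eq: "qset H = qset G"
    and f: "\<And>j a. j < provers (qset G) \<Longrightarrow> a \<in> alphabet G j \<Longrightarrow> f a \<in> alphabet H j"
    and g: "\<And>q a. q \<in> tuples (qset G) \<Longrightarrow> a \<in> (\<Pi>\<^sub>E j\<in>{..<provers (qset G)}. alphabet G j) \<Longrightarrow>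
              colour H q (\<lambda>j\<in>{..<provers (qset G)}. f (a j)) = g (colour G q a)"
  shows "cVal (game_power n H) \<le> cVal (game_power n G)"
proof (rule cVal_relabel_le)
  let ?r = "provers (qset G)"
  let ?f = "\<lambda>a. \<lambda>i\<in>{..<n}. f (a i)"
  let ?g = "\<lambda>c. \<lambda>i\<in>{..<n}. g (c i)"
  have r: "provers (qset (game_power n G)) = ?r"
    by (simp add: game_power_def qset_power_def)
  show "is_coloring_game (game_power n G)" "is_coloring_game (game_power n H)"
    using G H by (simp_all add: is_coloring_game_power)
  show "qset (game_power n H) = qset (game_power n G)"
    by (simp add: game_power_def eq)
  show "?f a \<in> alphabet (game_power n H) j"
    if "j < provers (qset (game_power n G))" "a \<in> alphabet (game_power n G) j" for j a
    using that f[of j] unfolding r by (auto simp: game_power_def PiE_def Pi_def)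
  show "colour (game_power n H) q (\<lambda>j\<in>{..<provers (qset (game_power n G))}. ?f (a j))
      = ?g (colour (game_power n G) q a)"
    if q: "q \<in> tuples (qset (game_power n G))"
      and a: "a \<in> (\<Pi>\<^sub>E j\<in>{..<provers (qset (game_power n G))}. alphabet (game_power n G) j)"
    for q a
  proof -
    have "colour H (round_of ?r i q) (round_of ?r i (\<lambda>j\<in>{..<?r}. ?f (a j)))
        = g (colour G (round_of ?r i q) (round_of ?r i a))" if i: "i < n" for i
    proof -
      have "round_of ?r i (\<lambda>j\<in>{..<?r}. ?f (a j)) = (\<lambda>j\<in>{..<?r}. f (round_of ?r i a j))"
        using i by (auto simp: round_of_def fun_eq_iff)
      moreover have "round_of ?r i q \<in> tuples (qset G)"
        using q i G by (intro round_of_in_tuples[of _ n]) (auto simp: game_power_def is_coloring_game_def)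
      moreover have "round_of ?r i a \<in> (\<Pi>\<^sub>E j\<in>{..<?r}. alphabet G j)"
        using a i unfolding r by (auto simp: game_power_def round_of_def PiE_def Pi_def)
      ultimately show ?thesis
        using g by simp
    qed
    then show ?thesis
      unfolding r by (auto simp: game_power_def eq fun_eq_iff)
  qed
qed

text \<open>The minimum ranges, up to relabelling, over games with arbitrary answer and color types.\<close>

theorem omega_CPR_le:
  fixes G :: "('q, 'a, 'x) coloring_game"
  assumes G: "is_coloring_game G" and Q: "qset G = Q" and ge: "cVal G \<ge> 2"
  shows "omega_CPR Q n \<le> enat (cVal (game_power n G))"
proof -
  let ?r = "provers Q"
  define A where "A = (\<Union>j<?r. alphabet G j)"
  define B where "B = (\<Pi>\<^sub>E j\<in>{..<?r}. alphabet G j)"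
  define C where "C = (\<lambda>(q, a). colour G q a) ` (tuples Q \<times> B)"
  have "finite A"
    using G Q unfolding A_def is_coloring_game_def by auto
  then obtain f :: "'a \<Rightarrow> nat" where f: "inj_on f A"
    using inj_on_to_nat_on[OF countable_finite] that by iprover
  have "finite C"
    using G Q unfolding C_def B_def is_coloring_game_def is_question_set_def
    by (intro finite_imageI finite_cartesian_product finite_PiE) auto
  then obtain g :: "'x \<Rightarrow> nat" where g: "inj_on g C"
    using inj_on_to_nat_on[OF countable_finite] that by iprover
  let ?f = "inv_into A f"
  let ?g = "inv_into C g"
  define H :: "('q, nat, nat) coloring_game" where
    "H = \<lparr>qset = Q, alphabet = (\<lambda>j. f ` alphabet G j),
          colour = (\<lambda>q b. g (colour G q (\<lambda>j\<in>{..<?r}. ?f (b j))))\<rparr>"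
  have H: "is_coloring_game H" and HQ: "qset H = Q"
    using G Q unfolding H_def is_coloring_game_def by auto
  have inv: "?f (f a) = a" if "j < ?r" "a \<in> alphabet G j" for j a
    using f that by (intro inv_into_f_f) (auto simp: A_def)
  have "cVal (game_power n H) \<le> cVal (game_power n G)"
  proof (rule cVal_power_relabel_le[OF G H, where f = f and g = g])
    show "colour H q (\<lambda>j\<in>{..<provers (qset G)}. f (a j)) = g (colour G q a)"
      if "q \<in> tuples (qset G)" "a \<in> (\<Pi>\<^sub>E j\<in>{..<provers (qset G)}. alphabet G j)" for q a
    proof -
      have "(\<lambda>j\<in>{..<?r}. ?f ((\<lambda>j\<in>{..<?r}. f (a j)) j)) = a"
      proof
        fix j
        show "(\<lambda>j\<in>{..<?r}. ?f ((\<lambda>j\<in>{..<?r}. f (a j)) j)) j = a j"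
        proof (cases "j < ?r")
          case True
          then have "a j \<in> alphabet G j"
            using that(2) unfolding Q by (simp add: PiE_iff)
          then show ?thesis
            using inv[OF True] True by simp
        next
          case False
          then show ?thesis
            using PiE_arb[OF that(2)] unfolding Q by simp
        qed
      qed
      then show ?thesis
        unfolding Q H_def by simp
    qed
  qed (auto simp: H_def Q)
  moreover have "cVal G \<le> cVal H"
  proof (rule cVal_relabel_le[OF H G, where f = ?f and g = ?g])
    show "?f b \<in> alphabet G j" if "j < provers (qset H)" "b \<in> alphabet H j" for j b
      using that inv by (auto simp: H_def)
    show "colour G q (\<lambda>j\<in>{..<provers (qset H)}. ?f (b j)) = ?g (colour H q b)"
      if "q \<in> tuples (qset H)" "b \<in> (\<Pi>\<^sub>E j\<in>{..<provers (qset H)}. alphabet H j)" for q b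
    proof -
      have "?f (b j) \<in> alphabet G j" if "j < ?r" for j
      proof -
        have "b j \<in> f ` alphabet G j"
          using \<open>b \<in> _\<close> that by (auto simp: H_def PiE_def Pi_def)
        then show ?thesis
          using inv[OF that] by auto
      qed
      then have "colour G q (\<lambda>j\<in>{..<?r}. ?f (b j)) \<in> C"
        using that(1) unfolding C_def B_def H_def
        by (intro image_eqI[of _ _ "(q, \<lambda>j\<in>{..<?r}. ?f (b j))"]) auto
      then show ?thesis
        using g by (simp add: H_def)
    qed
  qed (simp add: Q HQ)
  ultimately show ?thesis
    using H HQ ge unfolding omega_CPR_def
    by (intro Inf_lower2[of "enat (cVal (game_power n H))"]) auto
qed

end

(* A strategy for the n-fold game that produces at most k color vectors is a k-coloring of the
   words of length n over the tuples of the question set. For large n, the Hales-Jewett theorem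
   gives a monochromatic combinatorial line. On such a line each prover can compute its own vector
   of questions from its own question in a single tuple, and in an active coordinate i the tuple
   asked in round i is that single tuple. Answering as in round i is therefore a strategy for the
   original game that produces only one color. *)

theory Submission
  imports Defs
begin

section \<open>The Hales-Jewett theorem\<close>

text \<open>Words are lists rather than functions on \<open>{..<n}\<close> because color focusing
  keeps concatenating words and lines.\<close>

definition words :: "nat \<Rightarrow> 'b set \<Rightarrow> 'b list set" where
  "words n A = {w. set w \<subseteq> A \<and> length w = n}"

text \<open>Combinatorial lines are given by words with a variable, which is represented by \<open>None\<close>.\<close>

definition lines :: "nat \<Rightarrow> 'b set \<Rightarrow> 'b option list set" where
  "lines n A = {v. set v \<subseteq> insert None (Some ` A) \<and> None \<in> set v \<and> length v = n}"

definition subst :: "'b \<Rightarrow> 'b option list \<Rightarrow> 'b list" where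
  "subst x v = map (case_option x id) v"

definition monochromatic :: "('b list \<Rightarrow> 'c) \<Rightarrow> 'b set \<Rightarrow> 'b option list \<Rightarrow> bool" where
  "monochromatic c A v \<longleftrightarrow> (\<exists>col. \<forall>x\<in>A. c (subst x v) = col)"

lemma finite_words: "finite A \<Longrightarrow> finite (words n A)"
  unfolding words_def by (rule finite_lists_length_eq)

lemma words_append: "u \<in> words m A \<Longrightarrow> w \<in> words n A \<Longrightarrow> u @ w \<in> words (m + n) A"
  by (auto simp: words_def)

lemma words_mono: "A \<subseteq> B \<Longrightarrow> words n A \<subseteq> words n B"
  by (auto simp: words_def)

lemma subst_in_words: "v \<in> lines n A \<Longrightarrow> x \<in> A \<Longrightarrow> subst x v \<in> words n A"
  by (auto simp: words_def lines_def subst_def split: option.split)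

lemma lines_mono: "A \<subseteq> B \<Longrightarrow> lines n A \<subseteq> lines n B"
  by (auto simp: lines_def)

lemma lines_append: "u \<in> lines m A \<Longrightarrow> v \<in> lines n A \<Longrightarrow> u @ v \<in> lines (m + n) A"
  by (auto simp: lines_def)

lemma lines_append_word: "v \<in> lines m A \<Longrightarrow> w \<in> words n A \<Longrightarrow> v @ map Some w \<in> lines (m + n) A"
  by (auto simp: lines_def words_def)

lemma word_append_lines: "w \<in> words m A \<Longrightarrow> v \<in> lines n A \<Longrightarrow> map Some w @ v \<in> lines (m + n) A"
  by (auto simp: lines_def words_def)

lemma subst_append: "subst x (u @ v) = subst x u @ subst x v"
  by (simp add: subst_def)

lemma subst_map_Some: "subst x (map Some w) = w"
  by (simp add: subst_def comp_def)

text \<open>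
  Color focusing: \<open>C\<close> is the set of colors of \<open>s\<close> lines that are monochromatic on \<open>A\<close>, with
  different colors, and that all pass through \<open>f\<close> at the additional letter \<open>a\<close>.
\<close>

lemma colour_focusing:
  fixes A :: "'b set"
  assumes A: "finite A" "A \<noteq> {}"
    and HJ: "\<And>k. \<exists>m. \<forall>c :: 'b list \<Rightarrow> nat. c ` words m A \<subseteq> {..<k} \<longrightarrow>
               (\<exists>v\<in>lines m A. monochromatic c A v)"
  shows "\<exists>n. \<forall>c :: 'b list \<Rightarrow> nat. c ` words n (insert a A) \<subseteq> {..<k} \<longrightarrow>
           (\<exists>v\<in>lines n (insert a A). monochromatic c (insert a A) v) \<or>
           (\<exists>f\<in>words n (insert a A). \<exists>C. finite C \<and> card C = s \<and>
              (\<forall>\<gamma>\<in>C. \<exists>v\<in>lines n (insert a A). subst a v = f \<and> (\<forall>x\<in>A. c (subst x v) = \<gamma>)))"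
proof (induction s)
  case 0
  show ?case
    by (intro exI[of _ 0] allI impI disjI2 bexI[of _ "[]"] exI[of _ "{}"]) (auto simp: words_def)
next
  case (Suc s)
  let ?B = "insert a A"
  from Suc obtain n where n: "\<And>c :: 'b list \<Rightarrow> nat. c ` words n ?B \<subseteq> {..<k} \<Longrightarrow>
       (\<exists>v\<in>lines n ?B. monochromatic c ?B v) \<or>
       (\<exists>f\<in>words n ?B. \<exists>C. finite C \<and> card C = s \<and>
          (\<forall>\<gamma>\<in>C. \<exists>v\<in>lines n ?B. subst a v = f \<and> (\<forall>x\<in>A. c (subst x v) = \<gamma>)))"
    by blast
  \<comment> \<open>Each word \<open>w\<close> of the second block is colored by the whole map that
    sends \<open>u\<close> to the color of \<open>u @ w\<close>. There are \<open>card F\<close>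
    such maps, and this number of colors determines the length \<open>m\<close> of the second
    block.\<close>
  define F where "F = words n ?B \<rightarrow>\<^sub>E {..<k}"
  have "finite F"
    unfolding F_def using A by (intro finite_PiE finite_words) auto
  then obtain h where h: "bij_betw h F {..<card F}"
    using ex_bij_betw_finite_nat lessThan_atLeast0 by metis
  obtain m where m: "\<And>c :: 'b list \<Rightarrow> nat. c ` words m A \<subseteq> {..<card F} \<Longrightarrow>
      \<exists>v\<in>lines m A. monochromatic c A v"
    using HJ by blast
  obtain x0 where x0: "x0 \<in> A"
    using A by blast
  have "(\<exists>v\<in>lines (n + m) ?B. monochromatic c ?B v) \<or>
      (\<exists>f\<in>words (n + m) ?B. \<exists>C. finite C \<and> card C = Suc s \<and>
         (\<forall>\<gamma>\<in>C. \<exists>v\<in>lines (n + m) ?B. subst a v = f \<and> (\<forall>x\<in>A. c (subst x v) = \<gamma>)))"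
    if c: "c ` words (n + m) ?B \<subseteq> {..<k}" for c :: "'b list \<Rightarrow> nat"
  proof -
    define p where "p w = (\<lambda>u\<in>words n ?B. c (u @ w))" for w
    have cB: "c (u @ w) < k" if "u \<in> words n ?B" "w \<in> words m ?B" for u w
      using c words_append[OF that] by auto
    have pF: "p w \<in> F" if "w \<in> words m A" for w
      using that words_mono[of A ?B m] cB unfolding p_def F_def by auto
    have "(h \<circ> p) ` words m A \<subseteq> {..<card F}"
      using pF h by (auto simp: bij_betw_def)
    then obtain L where L: "L \<in> lines m A" and mono: "monochromatic (h \<circ> p) A L"
      using m by blast
    have LB: "L \<in> lines m ?B"
      using L lines_mono[of A ?B m] by auto
    have pL: "p (subst x L) = p (subst x0 L)" if "x \<in> A" for x
    proof -
      have "h (p (subst x L)) = h (p (subst x0 L))"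
        using mono that x0 by (auto simp: monochromatic_def)
      then show ?thesis
        using h pF subst_in_words[OF L] that x0 by (auto simp: bij_betw_def inj_on_def)
    qed
    \<comment> \<open>By \<open>pL\<close>, the choice of a letter of \<open>A\<close> for the
      variable of \<open>L\<close> does not affect colors, so \<open>c\<close> induces the coloring
      \<open>c'\<close> of the first block. The letter \<open>x0\<close> is arbitrary.\<close>
    define c' where "c' u = c (u @ subst x0 L)" for u
    have cL: "c (u @ subst x L) = c' u" if "u \<in> words n ?B" "x \<in> A" for u x
      using fun_cong[OF pL[OF that(2)], of u] that(1) by (simp add: p_def c'_def)
    have w0: "subst x0 L \<in> words m ?B"
      using LB x0 by (auto intro: subst_in_words)
    have "c' ` words n ?B \<subseteq> {..<k}"
      using cB w0 by (auto simp: c'_def)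
    from n[OF this] show ?thesis
    proof (elim disjE bexE exE conjE)
      fix v assume v: "v \<in> lines n ?B" "monochromatic c' ?B v"
      then have "monochromatic c ?B (v @ map Some (subst x0 L))"
        by (simp add: monochromatic_def subst_append subst_map_Some c'_def)
      then show ?thesis
        using lines_append_word[OF v(1) w0] by blast
    next
      fix f C
      assume f: "f \<in> words n ?B" and C: "finite C" "card C = s"
        and foc: "\<forall>\<gamma>\<in>C. \<exists>v\<in>lines n ?B. subst a v = f \<and> (\<forall>x\<in>A. c' (subst x v) = \<gamma>)"
      show ?thesis
      proof (cases "c' f \<in> C")
        \<comment> \<open>One of the focused lines has the color of its own focus, so it stays
          monochromatic when the letter \<open>a\<close> is added.\<close>
        case True
        then obtain v where v: "v \<in> lines n ?B" "subst a v = f" "\<forall>x\<in>A. c' (subst x v) = c' f"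
          using foc by blast
        then have "monochromatic c ?B (v @ map Some (subst x0 L))"
          by (auto simp: monochromatic_def subst_append subst_map_Some c'_def)
        then show ?thesis
          using lines_append_word[OF v(1) w0] by blast
      next
        case False
        \<comment> \<open>The new focus is \<open>f @ subst a L\<close>. Holding the first block at
          \<open>f\<close> and moving along \<open>L\<close> gives a line of the new color
          \<open>c' f\<close>; each old line \<open>v\<close> keeps its color as
          \<open>v @ L\<close>, with both blocks moving together.\<close>
        have "\<exists>v\<in>lines (n + m) ?B. subst a v = f @ subst a L \<and> (\<forall>x\<in>A. c (subst x v) = \<gamma>)"
          if \<gamma>: "\<gamma> \<in> insert (c' f) C" for \<gamma>
        proof (cases "\<gamma> = c' f")
          case True
          show ?thesis
            using True cL[OF f] word_append_lines[OF f LB]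
            by (intro bexI[of _ "map Some f @ L"]) (auto simp: subst_append subst_map_Some)
        next
          case False
          then obtain v where v: "v \<in> lines n ?B" "subst a v = f" "\<forall>x\<in>A. c' (subst x v) = \<gamma>"
            using foc \<gamma> by blast
          have "c (subst x v @ subst x L) = \<gamma>" if "x \<in> A" for x
            using cL[OF subst_in_words[OF v(1)]] v(3) that by auto
          then show ?thesis
            using v(2) lines_append[OF v(1) LB]
            by (intro bexI[of _ "v @ L"]) (auto simp: subst_append)
        qed
        moreover have "f @ subst a L \<in> words (n + m) ?B"
          using f LB by (intro words_append subst_in_words) auto
        moreover have "finite (insert (c' f) C)" "card (insert (c' f) C) = Suc s"
          using C False by auto
        ultimately show ?thesis
          by blast
      qed
    qed
  qed
  then show ?case
    by blast
qed

text \<open>Induction on the alphabet. The number \<open>k\<close> of colors is generalized because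
  color focusing needs the smaller alphabet with far more colors.\<close>

lemma Hales_Jewett_nat:
  fixes A :: "'b set"
  assumes "finite A" "A \<noteq> {}"
  shows "\<exists>n. \<forall>c :: 'b list \<Rightarrow> nat. c ` words n A \<subseteq> {..<k} \<longrightarrow>
           (\<exists>v\<in>lines n A. monochromatic c A v)"
  using assms
proof (induction A arbitrary: k rule: finite_ne_induct)
  case (singleton x)
  have "[None] \<in> lines 1 {x}" "monochromatic c {x} [None]" for c :: "'b list \<Rightarrow> nat"
    by (auto simp: lines_def monochromatic_def)
  then show ?case
    by blast
next
  case (insert a A)
  let ?B = "insert a A"
  \<comment> \<open>With \<open>Suc k\<close> differently colored focused lines, the second
    alternative would need more colors than there are.\<close>
  obtain n where n: "\<And>c :: 'b list \<Rightarrow> nat. c ` words n ?B \<subseteq> {..<k} \<Longrightarrow>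
       (\<exists>v\<in>lines n ?B. monochromatic c ?B v) \<or>
       (\<exists>f\<in>words n ?B. \<exists>C. finite C \<and> card C = Suc k \<and>
          (\<forall>\<gamma>\<in>C. \<exists>v\<in>lines n ?B. subst a v = f \<and> (\<forall>x\<in>A. c (subst x v) = \<gamma>)))"
    using colour_focusing[OF insert.hyps(1,2) insert.IH, where a = a and k = k and s = "Suc k"]
    by blast
  have "\<exists>v\<in>lines n ?B. monochromatic c ?B v"
    if c: "c ` words n ?B \<subseteq> {..<k}" for c :: "'b list \<Rightarrow> nat"
  proof (rule ccontr)
    assume "\<not> ?thesis"
    with n[OF c] obtain C f where C: "card C = Suc k"
      and foc: "\<forall>\<gamma>\<in>C. \<exists>v\<in>lines n ?B. subst a v = f \<and> (\<forall>x\<in>A. c (subst x v) = \<gamma>)"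
      by blast
    obtain x where x: "x \<in> A"
      using insert.hyps(2) by blast
    have "C \<subseteq> {..<k}"
    proof
      fix \<gamma> assume "\<gamma> \<in> C"
      then obtain v where "v \<in> lines n ?B" "c (subst x v) = \<gamma>"
        using foc x by blast
      then show "\<gamma> \<in> {..<k}"
        using c subst_in_words[of v n ?B x] x by auto
    qed
    then have "card C \<le> k"
      using card_mono[of "{..<k}" C] by simp
    then show False
      using C by simp
  qed
  then show ?case
    by blast
qed

text \<open>Colors of any type are renamed to numbers below \<open>k\<close>. Every length from
  \<open>N\<close> on is covered by padding the words with a constant letter, which adds only
  inactive coordinates to a line.\<close>

theorem Hales_Jewett:
  fixes A :: "'b set"
  assumes A: "finite A" "A \<noteq> {}"
  obtains N where "\<And>n (c :: 'b list \<Rightarrow> 'c). n \<ge> N \<Longrightarrow> card (c ` words n A) \<le> k \<Longrightarrow>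
    \<exists>v\<in>lines n A. monochromatic c A v"
proof -
  obtain N where N: "\<And>c :: 'b list \<Rightarrow> nat. c ` words N A \<subseteq> {..<k} \<Longrightarrow>
      \<exists>v\<in>lines N A. monochromatic c A v"
    using Hales_Jewett_nat[OF A] by blast
  obtain x0 where x0: "x0 \<in> A"
    using A by blast
  have "\<exists>v\<in>lines n A. monochromatic c A v"
    if n: "n \<ge> N" and c: "card (c ` words n A) \<le> k" for n and c :: "'b list \<Rightarrow> 'c"
  proof -
    let ?D = "c ` words n A"
    let ?z = "replicate (n - N) x0"
    have z: "?z \<in> words (n - N) A"
      using x0 by (auto simp: words_def)
    have "finite ?D"
      using A by (intro finite_imageI finite_words)
    then obtain h where h: "bij_betw h ?D {..<card ?D}"
      using ex_bij_betw_finite_nat lessThan_atLeast0 by metis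
    have D: "c (w @ ?z) \<in> ?D" if "w \<in> words N A" for w
      using words_append[OF that z] n by auto
    have "h (c (w @ ?z)) < k" if "w \<in> words N A" for w
      using bij_betw_apply[OF h D[OF that]] c by auto
    then have "(\<lambda>w. h (c (w @ ?z))) ` words N A \<subseteq> {..<k}"
      by auto
    then obtain v where v: "v \<in> lines N A" and mono: "monochromatic (\<lambda>w. h (c (w @ ?z))) A v"
      using N by blast
    have "c (subst x v @ ?z) = c (subst x0 v @ ?z)" if "x \<in> A" for x
    proof -
      have "h (c (subst x v @ ?z)) = h (c (subst x0 v @ ?z))"
        using mono that x0 by (auto simp: monochromatic_def)
      then show ?thesis
        using h D subst_in_words[OF v] that x0 by (auto simp: bij_betw_def dest: inj_onD)
    qed
    then have "monochromatic c A (v @ map Some ?z)"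
      by (auto simp only: monochromatic_def subst_append subst_map_Some)
    then show ?thesis
      using lines_append_word[OF v z] n by auto
  qed
  then show ?thesis
    using that by blast
qed

section \<open>Coloring games\<close>

lemma cVal_le: "is_coloring_game G \<Longrightarrow> S \<in> strategies G \<Longrightarrow> cVal G \<le> num_colours G S"
  unfolding cVal_def by (intro Min_le num_colours_set) auto

lemma cVal_attained:
  assumes "is_coloring_game G"
  obtains S where "S \<in> strategies G" "cVal G = num_colours G S"
proof -
  have "cVal G \<in> {num_colours G S | S. S \<in> strategies G}"
    unfolding cVal_def using num_colours_set[OF assms] by (rule Min_in)
  then show ?thesis
    using that by blast
qed

text \<open>\<open>T n w\<close> is the question tuple of the repeated game whose round
  \<open>i\<close> asks \<open>w ! i\<close>; thus \<open>S\<close> colors words by color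
  vectors.\<close>

lemma cVal_le_1_of_monochromatic_line:
  fixes G :: "('q, 'a, 'x) coloring_game"
  defines "r \<equiv> provers (qset G)"
  defines "T \<equiv> \<lambda>n w. transpose_rounds r n (\<lambda>i\<in>{..<n}. w ! i)"
  assumes G: "is_coloring_game G" and S: "S \<in> strategies (game_power n G)"
    and v: "v \<in> lines n (tuples (qset G))"
    and mono: "monochromatic (\<lambda>w. colour (game_power n G) (T n w) (answers r S (T n w)))
                 (tuples (qset G)) v"
  shows "cVal G \<le> 1"
proof -
  let ?Q = "qset G"
  have QE: "q \<in> (\<Pi>\<^sub>E j\<in>{..<r}. questions ?Q j)" if "q \<in> tuples ?Q" for q
    using G that unfolding is_coloring_game_def is_question_set_def r_def by auto
  have Qq: "q j \<in> questions ?Q j" if "q \<in> tuples ?Q" "j < r" for q j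
    using QE[OF that(1)] that(2) by auto
  have len: "length v = n" and vA: "set v \<subseteq> insert None (Some ` tuples ?Q)"
    using v by (auto simp: lines_def)
  obtain i where i: "i < n" "v ! i = None"
    using v by (auto simp: lines_def in_set_conv_nth)
  obtain col where col: "\<And>q. q \<in> tuples ?Q \<Longrightarrow>
      colour (game_power n G) (T n (subst q v)) (answers r S (T n (subst q v))) = col"
    using mono by (auto simp: monochromatic_def)
  \<comment> \<open>The question vector of prover \<open>j\<close> on the line: its own question
    \<open>x\<close> in active rounds, and its part of the prescribed tuple in the others. No other
    prover's question enters.\<close>
  define p where "p j x = (\<lambda>l\<in>{..<n}. case v ! l of None \<Rightarrow> x | Some t \<Rightarrow> t j)" for j x
  have p: "p j x \<in> {..<n} \<rightarrow>\<^sub>E questions ?Q j" if "j < r" "x \<in> questions ?Q j" for j x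
  proof -
    have "(case v ! l of None \<Rightarrow> x | Some t \<Rightarrow> t j) \<in> questions ?Q j" if l: "l < n" for l
    proof (cases "v ! l")
      case (Some t)
      then have "t \<in> tuples ?Q"
        using vA nth_mem[of l v] l len by auto
      then show ?thesis
        using Some Qq \<open>j < r\<close> by simp
    qed (simp add: \<open>x \<in> questions ?Q j\<close>)
    then show ?thesis
      by (auto simp: p_def)
  qed
  have Tp: "T n (subst q v) j = p j (q j)" if "j < r" for q j
  proof
    fix l show "T n (subst q v) j l = p j (q j) l"
      using that len by (cases "v ! l") (simp_all add: T_def transpose_rounds_def p_def subst_def)
  qed
  \<comment> \<open>Each prover simulates the repeated game on the line and keeps only its answer in
    the active round \<open>i\<close>.\<close>
  define S' where "S' = (\<lambda>j\<in>{..<r}. \<lambda>x\<in>questions ?Q j. S j (p j x) i)"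
  have SA: "S j (p j x) i \<in> alphabet G j" if "j < r" "x \<in> questions ?Q j" for j x
  proof -
    have "S j \<in> ({..<n} \<rightarrow>\<^sub>E questions ?Q j) \<rightarrow>\<^sub>E ({..<n} \<rightarrow>\<^sub>E alphabet G j)"
      using S that(1) unfolding strategies_def
      by (auto simp: game_power_def qset_power_def r_def)
    from PiE_mem[OF PiE_mem[OF this p[OF that]], of i] show ?thesis
      using i(1) by simp
  qed
  have S': "S' \<in> strategies G"
    using SA unfolding strategies_def S'_def r_def by auto
  have one: "colour G q (answers r S' q) = col i" if q: "q \<in> tuples ?Q" for q
  proof -
    have "round_of r i (T n (subst q v)) = q"
    proof
      fix j show "round_of r i (T n (subst q v)) j = q j"
        \<comment> \<open>For indices \<open>j\<close> outside \<open>{..<r}\<close> both sides are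
          \<open>undefined\<close>.\<close>
        using PiE_arb[OF QE[OF q], of j] i Tp[of j q]
        by (auto simp: round_of_def p_def)
    qed
    moreover have "round_of r i (answers r S (T n (subst q v))) = answers r S' q"
      using Qq[OF q] Tp[of _ q] by (intro ext) (simp add: round_of_def answers_def S'_def)
    moreover have "col i = colour G (round_of r i (T n (subst q v)))
        (round_of r i (answers r S (T n (subst q v))))"
      using i(1) unfolding col[OF q, symmetric] by (simp add: game_power_def r_def)
    ultimately show ?thesis
      by simp
  qed
  have "num_colours G S' \<le> card {col i}"
    unfolding num_colours_def using one by (intro card_mono) (auto simp: r_def)
  then show ?thesis
    using cVal_le[OF G S'] by simp
qed

text \<open>The Hales-Jewett bound depends only on \<open>tuples Q\<close> and \<open>k\<close>, so
  one \<open>N\<close> serves all games on \<open>Q\<close>, whatever their alphabets. This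
  uniformity is what the minimum over games requires.\<close>

lemma cVal_power_unbounded:
  fixes Q :: "'q question_set"
  assumes Q: "is_question_set Q"
  obtains N where "\<And>n (G :: ('q, 'a, 'x) coloring_game). n \<ge> N \<Longrightarrow> is_coloring_game G \<Longrightarrow>
    qset G = Q \<Longrightarrow> cVal G \<ge> 2 \<Longrightarrow> cVal (game_power n G) > k"
proof -
  have "finite (tuples Q)" "tuples Q \<noteq> {}"
    using Q by (auto simp: is_question_set_def)
  then obtain N where N: "\<And>n (c :: (nat \<Rightarrow> 'q) list \<Rightarrow> (nat \<Rightarrow> 'x)). n \<ge> N \<Longrightarrow>
      card (c ` words n (tuples Q)) \<le> k \<Longrightarrow> \<exists>v\<in>lines n (tuples Q). monochromatic c (tuples Q) v"
    using Hales_Jewett by blast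
  have "cVal (game_power n G) > k"
    if n: "n \<ge> N" and G: "is_coloring_game G" "qset G = Q" "cVal G \<ge> 2"
    for n and G :: "('q, 'a, 'x) coloring_game"
  proof (rule ccontr)
    assume "\<not> ?thesis"
    moreover obtain S where S: "S \<in> strategies (game_power n G)"
        "cVal (game_power n G) = num_colours (game_power n G) S"
      using cVal_attained[OF is_coloring_game_power[OF G(1)]] by blast
    ultimately have k: "num_colours (game_power n G) S \<le> k"
      by simp
    let ?r = "provers Q"
    let ?T = "\<lambda>w. transpose_rounds ?r n (\<lambda>i\<in>{..<n}. w ! i)"
    let ?c = "\<lambda>w. colour (game_power n G) (?T w) (answers ?r S (?T w))"
    let ?D = "{colour (game_power n G) q (answers ?r S q) | q. q \<in> tuples (qset_power n Q)}"
    have "?T w \<in> tuples (qset_power n Q)" if "w \<in> words n (tuples Q)" for w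
      using that by (auto simp: qset_power_def words_def intro!: imageI)
    \<comment> \<open>Coloring words by \<open>?c\<close> uses only color vectors that
      \<open>S\<close> produces, hence at most \<open>k\<close> of them.\<close>
    then have "?c ` words n (tuples Q) \<subseteq> ?D"
      by blast
    moreover have "finite ?D"
      using is_question_set_power[OF Q, of n] by (simp add: is_question_set_def)
    moreover have "card ?D \<le> k"
      using k G(2) by (simp add: num_colours_def game_power_def qset_power_def)
    ultimately have "card (?c ` words n (tuples Q)) \<le> k"
      by (meson card_mono le_trans)
    then obtain v where "v \<in> lines n (tuples Q)" "monochromatic ?c (tuples Q) v"
      using N[OF n] by blast
    then have "cVal G \<le> 1"
      using cVal_le_1_of_monochromatic_line[OF G(1) S(1)] G(2) by simp
    then show False
      using G(3) by simp
  qed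
  then show ?thesis
    using that by blast
qed

theorem theorem5p6:
  fixes Q :: "'q question_set"
  assumes "is_question_set Q"
  shows "(\<lambda>n. omega_CPR Q n) \<longlonglongrightarrow> \<infinity>"
proof (rule order_tendstoI)
  fix a :: enat assume "a < \<infinity>"
  then obtain k where k: "a = enat k"
    by (cases a) auto
  obtain N where N: "\<And>n (G :: ('q, nat, nat) coloring_game). n \<ge> N \<Longrightarrow> is_coloring_game G \<Longrightarrow>
      qset G = Q \<Longrightarrow> cVal G \<ge> 2 \<Longrightarrow> cVal (game_power n G) > k"
    using cVal_power_unbounded[OF assms] by blast
  have "a < omega_CPR Q n" if "n \<ge> N" for n
  proof -
    \<comment> \<open>An infimum inherits only non-strict bounds, hence \<open>Suc k\<close>. If no
      game is admissible, the infimum is \<infinity> and the bound still holds.\<close>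
    have "enat (Suc k) \<le> omega_CPR Q n"
      unfolding omega_CPR_def using N[OF that] by (intro Inf_greatest) (auto simp: Suc_le_eq)
    then show ?thesis
      unfolding k by (simp add: Suc_ile_eq)
  qed
  then show "\<forall>\<^sub>F n in sequentially. a < omega_CPR Q n"
    unfolding eventually_sequentially by blast
qed simp

end
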